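(* The class of quasi-Artinian Leibniz algebras is not $E$-closed; that is, there exists a Leibniz algebra $\mathfrak{g}$ that has a finite series $0=\mathfrak{g}_0\lhd\mathfrak{g}_1\lhd\cdots\lhd\mathfrak{g}_n=\mathfrak{g}$ with every factor $\mathfrak{g}_{i+1}/\mathfrak{g}_i$ $(0\le i\le n-1)$ quasi-Artinian, but $\mathfrak{g}$ itself is not quasi-Artinian.
   Context: A (left) Leibniz algebra is a vector space $\mathfrak{g}$ (of arbitrary dimension) over a field with a bilinear bracket satisfying $[x,[y,z]]=[[x,y],z]+[y,[x,z]]$ for all $x,y,z$. "Ideal" means two-sided ideal; $A\lhd B$ means that $A$ is an ideal of $B$. For subspaces $A,B$, $[A,B]$ is the linear span of all $[a,b]$, $a\in A$, $b\in B$. The derived series is $\mathfrak{g}^{(0)}=\mathfrak{g}$, $\mathfrak{g}^{(n+1)}=[\mathfrak{g}^{(n)},\mathfrak{g}^{(n)}]$. $\mathfrak{g}$ is left (resp. right) quasi-Artinian if for every descending chain of ideals $I_1\supseteq I_2\supseteq\cdots$ of $\mathfrak{g}$ there is $m\in\mathbb{N}$ such that $[\mathfrak{g}^{(m)},I_m]\subseteq I_n$ (resp. $[I_m,\mathfrak{g}^{(m)}]\subseteq I_n$) for all $n\in\mathbb{N}$; it is quasi-Artinian if it is both left and right quasi-Artinian. For a class $\mathfrak{X}$ of Leibniz algebras, $E\mathfrak{X}$ is the class of Leibniz algebras $\mathfrak{g}$ having a finite series $0=\mathfrak{g}_0\lhd\cdots\lhd\mathfrak{g}_n=\mathfrak{g}$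 with $\mathfrak{g}_{i+1}/\mathfrak{g}_i\in\mathfrak{X}$ for $0\le i\le n-1$; $\mathfrak{X}$ is $E$-closed if $E\mathfrak{X}=\mathfrak{X}$. *)

theory Defs
  imports "HOL-Algebra.Module" "HOL-Algebra.QuotRing"
begin

text \<open>
  A Leibniz algebra over \<open>K\<close> is a record of type \<open>module\<close> whose multiplication field
  is the bracket, so \<open>[x,y]\<close> is written \<open>x \<otimes>\<^bsub>L\<^esub> y\<close>. The field
  \<open>one\<close> of the record carries no meaning.
\<close>

locale leibniz_algebra = K?: field K + L?: module K L
  for K (structure) and L (structure) +
  assumes bracket_closed:
      "\<lbrakk>x \<in> carrier L; y \<in> carrier L\<rbrakk> \<Longrightarrow> x \<otimes>\<^bsub>L\<^esub> y \<in> carrier L"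
    and bracket_add_left:
      "\<lbrakk>x \<in> carrier L; y \<in> carrier L; z \<in> carrier L\<rbrakk> \<Longrightarrow>
        (x \<oplus>\<^bsub>L\<^esub> y) \<otimes>\<^bsub>L\<^esub> z = x \<otimes>\<^bsub>L\<^esub> z \<oplus>\<^bsub>L\<^esub> y \<otimes>\<^bsub>L\<^esub> z"
    and bracket_add_right:
      "\<lbrakk>x \<in> carrier L; y \<in> carrier L; z \<in> carrier L\<rbrakk> \<Longrightarrow>
        x \<otimes>\<^bsub>L\<^esub> (y \<oplus>\<^bsub>L\<^esub> z) = x \<otimes>\<^bsub>L\<^esub> y \<oplus>\<^bsub>L\<^esub> x \<otimes>\<^bsub>L\<^esub> z"
    and bracket_smult_left:
      "\<lbrakk>c \<in> carrier K; x \<in> carrier L; y \<in> carrier L\<rbrakk> \<Longrightarrow>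
        (c \<odot>\<^bsub>L\<^esub> x) \<otimes>\<^bsub>L\<^esub> y = c \<odot>\<^bsub>L\<^esub> (x \<otimes>\<^bsub>L\<^esub> y)"
    and bracket_smult_right:
      "\<lbrakk>c \<in> carrier K; x \<in> carrier L; y \<in> carrier L\<rbrakk> \<Longrightarrow>
        x \<otimes>\<^bsub>L\<^esub> (c \<odot>\<^bsub>L\<^esub> y) = c \<odot>\<^bsub>L\<^esub> (x \<otimes>\<^bsub>L\<^esub> y)"
    and leibniz_identity:
      "\<lbrakk>x \<in> carrier L; y \<in> carrier L; z \<in> carrier L\<rbrakk> \<Longrightarrow>
        x \<otimes>\<^bsub>L\<^esub> (y \<otimes>\<^bsub>L\<^esub> z) =
          (x \<otimes>\<^bsub>L\<^esub> y) \<otimes>\<^bsub>L\<^esub> z \<oplus>\<^bsub>L\<^esub> y \<otimes>\<^bsub>L\<^esub> (x \<otimes>\<^bsub>L\<^esub> z)"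

text \<open>
  The library's \<open>ideal\<close> presupposes an associative ring with unit.
\<close>

definition leibniz_ideal ::
    "('k, 'm) ring_scheme \<Rightarrow> ('k, 'v, 'n) module_scheme \<Rightarrow> 'v set \<Rightarrow> bool"
  where "leibniz_ideal K L I \<longleftrightarrow>
    submodule I K L \<and>
    (\<forall>x\<in>carrier L. \<forall>a\<in>I. x \<otimes>\<^bsub>L\<^esub> a \<in> I \<and> a \<otimes>\<^bsub>L\<^esub> x \<in> I)"

definition bracket_span ::
    "('k, 'm) ring_scheme \<Rightarrow> ('k, 'v, 'n) module_scheme \<Rightarrow> 'v set \<Rightarrow> 'v set \<Rightarrow> 'v set"
  where "bracket_span K L A B =
    \<Inter>{H. submodule H K L \<and> (\<forall>a\<in>A. \<forall>b\<in>B. a \<otimes>\<^bsub>L\<^esub> b \<in> H)}"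

primrec derived_series ::
    "('k, 'm) ring_scheme \<Rightarrow> ('k, 'v, 'n) module_scheme \<Rightarrow> nat \<Rightarrow> 'v set"
  where
    "derived_series K L 0 = carrier L"
  | "derived_series K L (Suc n) =
      bracket_span K L (derived_series K L n) (derived_series K L n)"

text \<open>
  As in \<open>FactRing\<close>, the operations on cosets are unions over all representatives; for an
  ideal \<open>I\<close> they reduce to the coset of the result on any choice of representatives.
\<close>

definition quotient_algebra ::
    "('k, 'v, 'n) module_scheme \<Rightarrow> 'v set \<Rightarrow> ('k, 'v set) module"
  where "quotient_algebra L I =
    \<lparr>carrier = a_rcosets\<^bsub>L\<^esub> I, mult = rcoset_mult L I,
      one = I +>\<^bsub>L\<^esub> \<one>\<^bsub>L\<^esub>, zero = I, add = set_add L,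
      smult = (\<lambda>c A. \<Union>a\<in>A. I +>\<^bsub>L\<^esub> (c \<odot>\<^bsub>L\<^esub> a))\<rparr>"

text \<open>Descending chains are indexed from 1, and the index \<open>0\<close> is ignored.\<close>

definition descending_ideal_chain ::
    "('k, 'm) ring_scheme \<Rightarrow> ('k, 'v, 'n) module_scheme \<Rightarrow> (nat \<Rightarrow> 'v set) \<Rightarrow> bool"
  where "descending_ideal_chain K L I \<longleftrightarrow>
    (\<forall>i\<ge>1. leibniz_ideal K L (I i) \<and> I (Suc i) \<subseteq> I i)"

definition left_quasi_artinian ::
    "('k, 'm) ring_scheme \<Rightarrow> ('k, 'v, 'n) module_scheme \<Rightarrow> bool"
  where "left_quasi_artinian K L \<longleftrightarrow>
    leibniz_algebra K L \<and>
    (\<forall>I. descending_ideal_chain K L I \<longrightarrow>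
      (\<exists>m\<ge>1. \<forall>n\<ge>1. bracket_span K L (derived_series K L m) (I m) \<subseteq> I n))"

definition right_quasi_artinian ::
    "('k, 'm) ring_scheme \<Rightarrow> ('k, 'v, 'n) module_scheme \<Rightarrow> bool"
  where "right_quasi_artinian K L \<longleftrightarrow>
    leibniz_algebra K L \<and>
    (\<forall>I. descending_ideal_chain K L I \<longrightarrow>
      (\<exists>m\<ge>1. \<forall>n\<ge>1. bracket_span K L (I m) (derived_series K L m) \<subseteq> I n))"

definition quasi_artinian ::
    "('k, 'm) ring_scheme \<Rightarrow> ('k, 'v, 'n) module_scheme \<Rightarrow> bool"
  where "quasi_artinian K L \<longleftrightarrow> left_quasi_artinian K L \<and> right_quasi_artinian K L"

text \<open>
  The class \<open>E X\<close>. The class \<open>X\<close> is applied to factors, whose elements are cosets,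
  hence its type. That every \<open>s i\<close> is a subalgebra of \<open>L\<close> follows by descent from
  \<open>s n = carrier L\<close>, each \<open>s i\<close> being an ideal of \<open>s (Suc i)\<close>.
\<close>

definition extension_class ::
    "('k, 'm) ring_scheme \<Rightarrow> (('k, 'v set) module \<Rightarrow> bool) \<Rightarrow>
      ('k, 'v, 'n) module_scheme \<Rightarrow> bool"
  where "extension_class K X L \<longleftrightarrow>
    leibniz_algebra K L \<and>
    (\<exists>n. \<exists>s :: nat \<Rightarrow> 'v set.
      s 0 = {\<zero>\<^bsub>L\<^esub>} \<and> s n = carrier L \<and>
      (\<forall>i<n. leibniz_ideal K (L\<lparr>carrier := s (Suc i)\<rparr>) (s i) \<and>
              X (quotient_algebra (L\<lparr>carrier := s (Suc i)\<rparr>) (s i))))"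

end

theory Submission
  imports Defs
begin

text \<open>
  The three-dimensional algebra \<open>S\<close> given by the cross product is simple and perfect over every
  field, also in characteristic 2. Let \<open>A\<close> be a product of infinitely many copies of the module
  \<open>S\<close>, with zero bracket and zero right action, and \<open>L = S \<oplus> A\<close>. Then \<open>A\<close> is abelian and
  \<open>L / A\<close> is simple, so both are quasi-Artinian. But \<open>L\<close> is perfect, and the subspaces \<open>T n\<close> of
  elements whose first \<open>n\<close> components, counting the one in \<open>S\<close>, vanish form a strictly descending chain of ideals with
  \<open>[L, T n] = T n\<close>.
\<close>

section \<open>Quotients\<close>

context leibniz_algebra
begin

lemma submodule_abelian_subgroup:
  assumes "submodule I K L"
  shows "abelian_subgroup I L"
  using assms M.abelian_group_axioms
  by (intro abelian_subgroupI3 additive_subgroup.intro) (auto simp: submodule_def)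

lemma zero_ideal: "leibniz_ideal K L {\<zero>\<^bsub>L\<^esub>}"
proof -
  have "x \<otimes>\<^bsub>L\<^esub> \<zero>\<^bsub>L\<^esub> = \<zero>\<^bsub>L\<^esub>" "\<zero>\<^bsub>L\<^esub> \<otimes>\<^bsub>L\<^esub> x = \<zero>\<^bsub>L\<^esub>" if "x \<in> carrier L" for x
    using bracket_smult_right[of "\<zero>\<^bsub>K\<^esub>" x "\<zero>\<^bsub>L\<^esub>"] bracket_smult_left[of "\<zero>\<^bsub>K\<^esub>" "\<zero>\<^bsub>L\<^esub>" x] that
    by (simp_all add: bracket_closed)
  moreover have "submodule {\<zero>\<^bsub>L\<^esub>} K L"
    by (rule submoduleI) (auto simp: M.add.inv_one)
  ultimately show ?thesis by (simp add: leibniz_ideal_def)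
qed

lemma subalgebra:
  assumes "submodule H K L" and "\<And>x y. x \<in> H \<Longrightarrow> y \<in> H \<Longrightarrow> x \<otimes>\<^bsub>L\<^esub> y \<in> H"
  shows "leibniz_algebra K (L\<lparr>carrier := H\<rparr>)"
proof -
  interpret M: module K "L\<lparr>carrier := H\<rparr>"
    using submodule.submodule_is_module[OF assms(1) module_axioms] .
  have H: "x \<in> carrier L" if "x \<in> H" for x
    using submoduleE(1)[OF assms(1)] that by blast
  show ?thesis
    by unfold_locales
      (auto simp: H assms(2) bracket_add_left bracket_add_right bracket_smult_left
        bracket_smult_right intro: leibniz_identity)
qed

lemma bracket_span_subset:
  assumes "submodule H K L" and "\<And>a b. a \<in> A \<Longrightarrow> b \<in> B \<Longrightarrow> a \<otimes>\<^bsub>L\<^esub> b \<in> H"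
  shows "bracket_span K L A B \<subseteq> H"
  using assms unfolding bracket_span_def by blast

lemma bracket_span_carrier:
  assumes "A \<subseteq> carrier L" "B \<subseteq> carrier L"
  shows "bracket_span K L A B \<subseteq> carrier L"
  using assms by (intro bracket_span_subset carrier_is_submodule bracket_closed) auto

lemma derived_series_subset: "derived_series K L n \<subseteq> carrier L"
  by (induction n) (simp_all add: bracket_span_carrier)

text \<open>Either every term of a chain is the whole algebra, and \<open>m = 1\<close> works, or
  some term \<open>I m\<close> is proper and brackets to zero with everything on both sides, so that
  both spans lie in every \<open>I n\<close>. Abelian algebras and simple ones both meet the
  hypothesis, so one criterion serves both factors of the series.\<close>

lemma quasi_artinianI:
  assumes ideals: "\<And>P. leibniz_ideal K L P \<Longrightarrow> P = carrier L \<or>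
    (\<forall>x\<in>carrier L. \<forall>a\<in>P. x \<otimes>\<^bsub>L\<^esub> a = \<zero>\<^bsub>L\<^esub> \<and> a \<otimes>\<^bsub>L\<^esub> x = \<zero>\<^bsub>L\<^esub>)"
  shows "quasi_artinian K L"
proof -
  have "\<exists>m\<ge>1. \<forall>n\<ge>1. bracket_span K L (derived_series K L m) (I m) \<subseteq> I n \<and>
      bracket_span K L (I m) (derived_series K L m) \<subseteq> I n"
    if "descending_ideal_chain K L I" for I
  proof -
    have I: "leibniz_ideal K L (I n)" if "n \<ge> 1" for n
      using that \<open>descending_ideal_chain K L I\<close> by (simp add: descending_ideal_chain_def)
    have sub: "submodule (I n) K L" if "n \<ge> 1" for n
      using I[OF that] by (simp add: leibniz_ideal_def)
    show ?thesis
    proof (cases "\<forall>n\<ge>1. I n = carrier L")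
      case True
      then show ?thesis
        by (intro exI[of _ 1])
          (simp add: bracket_span_carrier derived_series_subset del: derived_series.simps)
    next
      case False
      then obtain m where m: "m \<ge> 1" "I m \<noteq> carrier L" by blast
      have zero: "\<zero>\<^bsub>L\<^esub> \<in> I n" if "n \<ge> 1" for n
        using subgroup.one_closed[OF submodule.axioms(1)[OF sub[OF that]]] by simp
      have "x \<otimes>\<^bsub>L\<^esub> a = \<zero>\<^bsub>L\<^esub> \<and> a \<otimes>\<^bsub>L\<^esub> x = \<zero>\<^bsub>L\<^esub>"
        if "x \<in> derived_series K L m" "a \<in> I m" for x a
        using ideals[OF I[OF m(1)]] m(2) that derived_series_subset by blast
      then show ?thesis
        using m(1) by (intro exI[of _ m] conjI allI impI bracket_span_subset sub)
          (auto simp: zero)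
    qed
  qed
  then show ?thesis
    using leibniz_algebra_axioms
    unfolding quasi_artinian_def left_quasi_artinian_def right_quasi_artinian_def by metis
qed

section \<open>The quotient by an ideal\<close>

context
  fixes I
  assumes ideal: "leibniz_ideal K L I"
begin

interpretation I: abelian_subgroup I L
  using ideal submodule_abelian_subgroup by (simp add: leibniz_ideal_def)

lemma coset_eq_iff:
  assumes "x \<in> carrier L" "y \<in> carrier L"
  shows "I +>\<^bsub>L\<^esub> x = I +>\<^bsub>L\<^esub> y \<longleftrightarrow> (\<exists>h\<in>I. x = h \<oplus>\<^bsub>L\<^esub> y)"
proof -
  have "I +>\<^bsub>L\<^esub> x = I +>\<^bsub>L\<^esub> y \<longleftrightarrow> x \<in> I +>\<^bsub>L\<^esub> y"
    using I.a_repr_independence' I.a_rcos_self assms by metis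
  then show ?thesis by (auto simp: a_r_coset_def')
qed

lemma mem_coset:
  assumes "a \<in> I +>\<^bsub>L\<^esub> x" "x \<in> carrier L"
  shows "\<exists>h\<in>I. a = h \<oplus>\<^bsub>L\<^esub> x"
  using assms by (auto simp: a_r_coset_def')

text \<open>\<open>rcoset_mult\<close> is a union over all representatives. Expanding
  \<open>(h + x)(k + y)\<close> leaves \<open>x y\<close> plus terms with a factor \<open>h\<close>
  or \<open>k\<close>; these lie in \<open>I\<close> because the ideal is two-sided, so all cosets
  in the union coincide.\<close>

lemma rcoset_bracket:
  assumes x: "x \<in> carrier L" and y: "y \<in> carrier L"
  shows "rcoset_mult L I (I +>\<^bsub>L\<^esub> x) (I +>\<^bsub>L\<^esub> y) = I +>\<^bsub>L\<^esub> (x \<otimes>\<^bsub>L\<^esub> y)"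
proof -
  have "I +>\<^bsub>L\<^esub> (a \<otimes>\<^bsub>L\<^esub> b) = I +>\<^bsub>L\<^esub> (x \<otimes>\<^bsub>L\<^esub> y)"
    if a: "a \<in> I +>\<^bsub>L\<^esub> x" and b: "b \<in> I +>\<^bsub>L\<^esub> y" for a b
  proof -
    obtain h k where h: "h \<in> I" "a = h \<oplus>\<^bsub>L\<^esub> x" and k: "k \<in> I" "b = k \<oplus>\<^bsub>L\<^esub> y"
      using mem_coset a b x y by metis
    note c = x y h(1)[THEN I.a_Hcarr] k(1)[THEN I.a_Hcarr]
    have "a \<otimes>\<^bsub>L\<^esub> b = (h \<otimes>\<^bsub>L\<^esub> (k \<oplus>\<^bsub>L\<^esub> y) \<oplus>\<^bsub>L\<^esub> x \<otimes>\<^bsub>L\<^esub> k) \<oplus>\<^bsub>L\<^esub> x \<otimes>\<^bsub>L\<^esub> y"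
      using c by (simp add: h k bracket_add_left bracket_add_right bracket_closed M.a_ac)
    moreover have "h \<otimes>\<^bsub>L\<^esub> (k \<oplus>\<^bsub>L\<^esub> y) \<oplus>\<^bsub>L\<^esub> x \<otimes>\<^bsub>L\<^esub> k \<in> I"
      using ideal c h k by (simp add: leibniz_ideal_def)
    moreover have "a \<otimes>\<^bsub>L\<^esub> b \<in> carrier L"
      using c h k by (simp add: bracket_closed)
    ultimately show ?thesis
      using c by (subst coset_eq_iff) (auto simp: bracket_closed)
  qed
  then show ?thesis
    unfolding rcoset_mult_def using I.a_rcos_self x y by blast
qed

lemma coset_smult:
  assumes c: "c \<in> carrier K" and x: "x \<in> carrier L"
  shows "(\<Union>a\<in>I +>\<^bsub>L\<^esub> x. I +>\<^bsub>L\<^esub> (c \<odot>\<^bsub>L\<^esub> a)) = I +>\<^bsub>L\<^esub> (c \<odot>\<^bsub>L\<^esub> x)"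
proof -
  have "I +>\<^bsub>L\<^esub> (c \<odot>\<^bsub>L\<^esub> a) = I +>\<^bsub>L\<^esub> (c \<odot>\<^bsub>L\<^esub> x)" if a: "a \<in> I +>\<^bsub>L\<^esub> x" for a
  proof -
    obtain h where h: "h \<in> I" "a = h \<oplus>\<^bsub>L\<^esub> x" using mem_coset a x by metis
    note ch = h(1)[THEN I.a_Hcarr]
    have "c \<odot>\<^bsub>L\<^esub> a = c \<odot>\<^bsub>L\<^esub> h \<oplus>\<^bsub>L\<^esub> c \<odot>\<^bsub>L\<^esub> x"
      using c x ch by (simp add: h smult_r_distr)
    moreover have "c \<odot>\<^bsub>L\<^esub> h \<in> I"
      using ideal c h unfolding leibniz_ideal_def by (blast intro: submodule.smult_closed)
    ultimately show ?thesis
      using c x ch h by (subst coset_eq_iff) auto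
  qed
  then show ?thesis using I.a_rcos_self x by blast
qed

text \<open>Every operation is reduced to representatives, after which the axioms of the quotient
  follow from those of \<open>L\<close> by rewriting.\<close>

lemma quotient_algebra_simps:
  "carrier (quotient_algebra L I) = (+>\<^bsub>L\<^esub>) I ` carrier L"
  "\<zero>\<^bsub>quotient_algebra L I\<^esub> = I"
  "\<lbrakk>x \<in> carrier L; y \<in> carrier L\<rbrakk> \<Longrightarrow>
    (I +>\<^bsub>L\<^esub> x) \<oplus>\<^bsub>quotient_algebra L I\<^esub> (I +>\<^bsub>L\<^esub> y) = I +>\<^bsub>L\<^esub> (x \<oplus>\<^bsub>L\<^esub> y)"
  "\<lbrakk>x \<in> carrier L; y \<in> carrier L\<rbrakk> \<Longrightarrow>
    (I +>\<^bsub>L\<^esub> x) \<otimes>\<^bsub>quotient_algebra L I\<^esub> (I +>\<^bsub>L\<^esub> y) = I +>\<^bsub>L\<^esub> (x \<otimes>\<^bsub>L\<^esub> y)"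
  "\<lbrakk>c \<in> carrier K; x \<in> carrier L\<rbrakk> \<Longrightarrow>
    c \<odot>\<^bsub>quotient_algebra L I\<^esub> (I +>\<^bsub>L\<^esub> x) = I +>\<^bsub>L\<^esub> (c \<odot>\<^bsub>L\<^esub> x)"
  by (auto simp: quotient_algebra_def A_RCOSETS_def' I.a_rcos_sum rcoset_bracket coset_smult)

lemma quotient_leibniz_algebra: "leibniz_algebra K (quotient_algebra L I)"
proof -
  have "abelian_group (quotient_algebra L I)"
  proof (rule abelian_groupI)
    fix X assume "X \<in> carrier (quotient_algebra L I)"
    then obtain x where x: "x \<in> carrier L" "X = I +>\<^bsub>L\<^esub> x"
      by (auto simp: quotient_algebra_simps)
    have I0: "I = I +>\<^bsub>L\<^esub> \<zero>\<^bsub>L\<^esub>" using I.a_subset by simp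
    show "\<zero>\<^bsub>quotient_algebra L I\<^esub> \<oplus>\<^bsub>quotient_algebra L I\<^esub> X = X"
      using x quotient_algebra_simps(3)[of "\<zero>\<^bsub>L\<^esub>" x] I0 by (simp add: quotient_algebra_simps(2))
    show "\<exists>Y\<in>carrier (quotient_algebra L I).
        Y \<oplus>\<^bsub>quotient_algebra L I\<^esub> X = \<zero>\<^bsub>quotient_algebra L I\<^esub>"
      using x I0 by (intro bexI[of _ "I +>\<^bsub>L\<^esub> (\<ominus>\<^bsub>L\<^esub> x)"])
        (auto simp: quotient_algebra_simps M.l_neg)
  next
    show "\<zero>\<^bsub>quotient_algebra L I\<^esub> \<in> carrier (quotient_algebra L I)"
      using I.a_subset by (auto simp: quotient_algebra_simps intro!: image_eqI[of _ _ "\<zero>\<^bsub>L\<^esub>"])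
  qed (auto simp: quotient_algebra_simps M.a_ac)
  then have "module K (quotient_algebra L I)"
    by (intro moduleI K.is_cring)
      (auto simp: quotient_algebra_simps smult_l_distr smult_r_distr smult_assoc1)
  then show ?thesis
    by (intro leibniz_algebra.intro leibniz_algebra_axioms.intro K.field_axioms)
      (auto simp: quotient_algebra_simps bracket_closed bracket_add_left bracket_add_right
        bracket_smult_left bracket_smult_right leibniz_identity[symmetric])
qed

text \<open>The half of the correspondence theorem that is needed to control the ideals of the
  quotient by those of \<open>L\<close>.\<close>

lemma ideal_pullback:
  assumes J: "leibniz_ideal K (quotient_algebra L I) J"
  shows "leibniz_ideal K L {x \<in> carrier L. I +>\<^bsub>L\<^esub> x \<in> J}"
proof -
  interpret Q: leibniz_algebra K "quotient_algebra L I" by (rule quotient_leibniz_algebra)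
  have sub: "submodule J K (quotient_algebra L I)" using J by (simp add: leibniz_ideal_def)
  note E = Q.submoduleE[OF sub]
  have add: "I +>\<^bsub>L\<^esub> (x \<oplus>\<^bsub>L\<^esub> y) \<in> J"
    if "x \<in> carrier L" "y \<in> carrier L" "I +>\<^bsub>L\<^esub> x \<in> J" "I +>\<^bsub>L\<^esub> y \<in> J" for x y
    using E(5)[OF that(3,4)] that by (simp add: quotient_algebra_simps)
  have smult: "I +>\<^bsub>L\<^esub> (c \<odot>\<^bsub>L\<^esub> x) \<in> J" if "c \<in> carrier K" "x \<in> carrier L" "I +>\<^bsub>L\<^esub> x \<in> J" for c x
    using E(4)[OF that(1,3)] that by (simp add: quotient_algebra_simps)
  have zero: "I +>\<^bsub>L\<^esub> \<zero>\<^bsub>L\<^esub> \<in> J"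
    using subgroup.one_closed[OF submodule.axioms(1)[OF sub]]
    by (simp add: quotient_algebra_simps I.a_subset)
  have minus: "I +>\<^bsub>L\<^esub> (\<ominus>\<^bsub>L\<^esub> x) \<in> J" if "x \<in> carrier L" "I +>\<^bsub>L\<^esub> x \<in> J" for x
    using smult[of "\<ominus>\<^bsub>K\<^esub> \<one>\<^bsub>K\<^esub>" x] that by (simp add: smult_l_minus)
  have bracket: "I +>\<^bsub>L\<^esub> (x \<otimes>\<^bsub>L\<^esub> a) \<in> J \<and> I +>\<^bsub>L\<^esub> (a \<otimes>\<^bsub>L\<^esub> x) \<in> J"
    if "x \<in> carrier L" "a \<in> carrier L" "I +>\<^bsub>L\<^esub> a \<in> J" for x a
  proof -
    have "I +>\<^bsub>L\<^esub> x \<in> carrier (quotient_algebra L I)"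
      using that by (simp add: quotient_algebra_simps)
    with J that(3) have "(I +>\<^bsub>L\<^esub> x) \<otimes>\<^bsub>quotient_algebra L I\<^esub> (I +>\<^bsub>L\<^esub> a) \<in> J \<and>
        (I +>\<^bsub>L\<^esub> a) \<otimes>\<^bsub>quotient_algebra L I\<^esub> (I +>\<^bsub>L\<^esub> x) \<in> J"
      unfolding leibniz_ideal_def by blast
    with that show ?thesis by (simp add: quotient_algebra_simps)
  qed
  show ?thesis
    unfolding leibniz_ideal_def
    by (auto intro!: submoduleI add smult zero minus simp: bracket bracket_closed)
qed

text \<open>The criterion \<open>quasi_artinianI\<close> stated upstairs: the preimage of an ideal
  \<open>J\<close> is an ideal of \<open>L\<close>, and brackets that fall into \<open>I\<close>
  become the zero coset. Chains in the quotient thus never have to be handled directly.\<close>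

lemma quotient_quasi_artinian:
  assumes ideals: "\<And>P. leibniz_ideal K L P \<Longrightarrow> P = carrier L \<or>
    (\<forall>x\<in>carrier L. \<forall>a\<in>P. x \<otimes>\<^bsub>L\<^esub> a \<in> I \<and> a \<otimes>\<^bsub>L\<^esub> x \<in> I)"
  shows "quasi_artinian K (quotient_algebra L I)"
proof -
  interpret Q: leibniz_algebra K "quotient_algebra L I" by (rule quotient_leibniz_algebra)
  show ?thesis
  proof (rule Q.quasi_artinianI)
    fix J assume J: "leibniz_ideal K (quotient_algebra L I) J"
    have sub: "J \<subseteq> (+>\<^bsub>L\<^esub>) I ` carrier L"
      using J Q.submoduleE(1) by (auto simp: leibniz_ideal_def quotient_algebra_simps)
    from ideals[OF ideal_pullback[OF J]]
    show "J = carrier (quotient_algebra L I) \<or>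
      (\<forall>x\<in>carrier (quotient_algebra L I). \<forall>a\<in>J.
        x \<otimes>\<^bsub>quotient_algebra L I\<^esub> a = \<zero>\<^bsub>quotient_algebra L I\<^esub> \<and>
        a \<otimes>\<^bsub>quotient_algebra L I\<^esub> x = \<zero>\<^bsub>quotient_algebra L I\<^esub>)"
    proof
      assume "{x \<in> carrier L. I +>\<^bsub>L\<^esub> x \<in> J} = carrier L"
      then show ?thesis using sub by (auto simp: quotient_algebra_simps)
    next
      assume *: "\<forall>x\<in>carrier L. \<forall>a\<in>{x \<in> carrier L. I +>\<^bsub>L\<^esub> x \<in> J}.
        x \<otimes>\<^bsub>L\<^esub> a \<in> I \<and> a \<otimes>\<^bsub>L\<^esub> x \<in> I"
      have "X \<otimes>\<^bsub>quotient_algebra L I\<^esub> B = I \<and> B \<otimes>\<^bsub>quotient_algebra L I\<^esub> X = I"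
        if X: "X \<in> carrier (quotient_algebra L I)" and B: "B \<in> J" for X B
      proof -
        obtain x b where "x \<in> carrier L" "X = I +>\<^bsub>L\<^esub> x" "b \<in> carrier L" "B = I +>\<^bsub>L\<^esub> b"
          using X B sub by (auto simp: quotient_algebra_simps)
        then show ?thesis
          using * B by (simp add: quotient_algebra_simps I.a_rcos_const)
      qed
      then show ?thesis by (simp add: quotient_algebra_simps)
    qed
  qed
qed

end

end

section \<open>Sequences of vectors under the cross product\<close>

text \<open>A sequence \<open>f\<close> encodes the vectors \<open>(f (3 i), f (3 i + 1), f (3 i + 2))\<close>, and the
  \<open>i\<close>-th vector of the bracket of \<open>f\<close> and \<open>g\<close> is the cross product of the zeroth vector
  of \<open>f\<close> with the \<open>i\<close>-th vector of \<open>g\<close>.\<close>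

definition cross_bracket ::
    "('k, 'm) ring_scheme \<Rightarrow> (nat \<Rightarrow> 'k) \<Rightarrow> (nat \<Rightarrow> 'k) \<Rightarrow> nat \<Rightarrow> 'k"
  where "cross_bracket K f g n =
    (if n mod 3 = 0 then f 1 \<otimes>\<^bsub>K\<^esub> g (n + 2) \<ominus>\<^bsub>K\<^esub> f 2 \<otimes>\<^bsub>K\<^esub> g (n + 1)
     else if n mod 3 = 1 then f 2 \<otimes>\<^bsub>K\<^esub> g (n - 1) \<ominus>\<^bsub>K\<^esub> f 0 \<otimes>\<^bsub>K\<^esub> g (n + 1)
     else f 0 \<otimes>\<^bsub>K\<^esub> g (n - 1) \<ominus>\<^bsub>K\<^esub> f 1 \<otimes>\<^bsub>K\<^esub> g (n - 2))"

text \<open>Block 0 of a sequence is its component in \<open>S\<close>; the later blocks together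
  are its component in \<open>A\<close>. Since the bracket reads only block 0 of its left factor,
  the right action on \<open>A\<close> is zero.\<close>

definition cross_algebra :: "('k, 'm) ring_scheme \<Rightarrow> ('k, nat \<Rightarrow> 'k) module"
  where "cross_algebra K =
    \<lparr>carrier = UNIV \<rightarrow> carrier K, mult = cross_bracket K, one = (\<lambda>_. \<zero>\<^bsub>K\<^esub>),
      zero = (\<lambda>_. \<zero>\<^bsub>K\<^esub>), add = (\<lambda>f g n. f n \<oplus>\<^bsub>K\<^esub> g n),
      smult = (\<lambda>c f n. c \<otimes>\<^bsub>K\<^esub> f n)\<rparr>"

text \<open>This is \<open>T n\<close>: the bound \<open>3 * n\<close> cuts off \<open>n\<close>
  whole blocks. Thus \<open>tail K 1\<close> is \<open>A\<close>, and \<open>tail K 0\<close> is the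
  whole algebra.\<close>

definition tail :: "('k, 'm) ring_scheme \<Rightarrow> nat \<Rightarrow> (nat \<Rightarrow> 'k) set"
  where "tail K n = {f \<in> UNIV \<rightarrow> carrier K. \<forall>k<3 * n. f k = \<zero>\<^bsub>K\<^esub>}"

definition unit_seq :: "('k, 'm) ring_scheme \<Rightarrow> nat \<Rightarrow> nat \<Rightarrow> 'k"
  where "unit_seq K i n = (if n = i then \<one>\<^bsub>K\<^esub> else \<zero>\<^bsub>K\<^esub>)"

lemma mod3_cases:
  fixes n :: nat
  obtains q where "n = 3 * q" | q where "n = 3 * q + 1" | q where "n = 3 * q + 2"
proof -
  have "n = 3 * (n div 3) \<or> n = 3 * (n div 3) + 1 \<or> n = 3 * (n div 3) + 2" by presburger
  then show ?thesis using that by blast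
qed

lemma cross_bracket_block:
  "cross_bracket K f g (3 * q) =
    f 1 \<otimes>\<^bsub>K\<^esub> g (3 * q + 2) \<ominus>\<^bsub>K\<^esub> f 2 \<otimes>\<^bsub>K\<^esub> g (3 * q + 1)"
  "cross_bracket K f g (3 * q + 1) =
    f 2 \<otimes>\<^bsub>K\<^esub> g (3 * q) \<ominus>\<^bsub>K\<^esub> f 0 \<otimes>\<^bsub>K\<^esub> g (3 * q + 2)"
  "cross_bracket K f g (3 * q + 2) =
    f 0 \<otimes>\<^bsub>K\<^esub> g (3 * q + 1) \<ominus>\<^bsub>K\<^esub> f 1 \<otimes>\<^bsub>K\<^esub> g (3 * q)"
  by (simp_all add: cross_bracket_def mod_Suc)

text \<open>The block formulas at \<open>q = 0\<close> with evaluated indices. They are needed when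
  a bracket stands as the left factor of another, where only the entries 0, 1, 2 are read.\<close>

lemma cross_bracket_zeroth:
  "cross_bracket K f g 0 = f 1 \<otimes>\<^bsub>K\<^esub> g 2 \<ominus>\<^bsub>K\<^esub> f 2 \<otimes>\<^bsub>K\<^esub> g 1"
  "cross_bracket K f g 1 = f 2 \<otimes>\<^bsub>K\<^esub> g 0 \<ominus>\<^bsub>K\<^esub> f 0 \<otimes>\<^bsub>K\<^esub> g 2"
  "cross_bracket K f g 2 = f 0 \<otimes>\<^bsub>K\<^esub> g 1 \<ominus>\<^bsub>K\<^esub> f 1 \<otimes>\<^bsub>K\<^esub> g 0"
  by (simp_all add: cross_bracket_def numeral_2_eq_2)

lemma cross_algebra_simps:
  "carrier (cross_algebra K) = UNIV \<rightarrow> carrier K"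
  "x \<otimes>\<^bsub>cross_algebra K\<^esub> y = cross_bracket K x y"
  "\<zero>\<^bsub>cross_algebra K\<^esub> = (\<lambda>_. \<zero>\<^bsub>K\<^esub>)"
  "x \<oplus>\<^bsub>cross_algebra K\<^esub> y = (\<lambda>n. x n \<oplus>\<^bsub>K\<^esub> y n)"
  "c \<odot>\<^bsub>cross_algebra K\<^esub> x = (\<lambda>n. c \<otimes>\<^bsub>K\<^esub> x n)"
  by (simp_all add: cross_algebra_def)

section \<open>The Leibniz identity for the cross bracket\<close>

context field
begin

lemma cross_bracket_closed:
  "\<lbrakk>f \<in> UNIV \<rightarrow> carrier R; g \<in> UNIV \<rightarrow> carrier R\<rbrakk> \<Longrightarrow>
    cross_bracket R f g \<in> UNIV \<rightarrow> carrier R"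
  by (auto simp: cross_bracket_def Pi_iff)

lemma minus_zero [simp]: "a \<in> carrier R \<Longrightarrow> a \<ominus> \<zero> = a" "a \<in> carrier R \<Longrightarrow> \<zero> \<ominus> a = \<ominus> a"
  by (simp_all add: a_minus_def)

lemma add_minus_add:
  assumes "a \<in> carrier R" "b \<in> carrier R" "c \<in> carrier R" "d \<in> carrier R"
  shows "(a \<oplus> b) \<ominus> (c \<oplus> d) = (a \<ominus> c) \<oplus> (b \<ominus> d)"
  using assms by (simp add: a_minus_def minus_add a_ac)

lemma mult_minus_mult:
  assumes "e \<in> carrier R" "a \<in> carrier R" "b \<in> carrier R"
  shows "e \<otimes> (a \<ominus> b) = e \<otimes> a \<ominus> e \<otimes> b"
  using assms by (simp add: a_minus_def r_distr r_minus)

text \<open>One coordinate of the identity saying that \<open>x\<close> acts on cross products as a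
  derivation. Cyclic permutation of the indices 1, 2, 3 gives the other two coordinates.\<close>

lemma cross_leibniz_coordinate:
  assumes "x1 \<in> carrier R" "x2 \<in> carrier R" "x3 \<in> carrier R"
    "y1 \<in> carrier R" "y2 \<in> carrier R" "y3 \<in> carrier R"
    "z1 \<in> carrier R" "z2 \<in> carrier R" "z3 \<in> carrier R"
  shows "x2 \<otimes> (y1 \<otimes> z2 \<ominus> y2 \<otimes> z1) \<ominus> x3 \<otimes> (y3 \<otimes> z1 \<ominus> y1 \<otimes> z3) =
    ((x3 \<otimes> y1 \<ominus> x1 \<otimes> y3) \<otimes> z3 \<ominus> (x1 \<otimes> y2 \<ominus> x2 \<otimes> y1) \<otimes> z2) \<oplus>
    (y2 \<otimes> (x1 \<otimes> z2 \<ominus> x2 \<otimes> z1) \<ominus> y3 \<otimes> (x3 \<otimes> z1 \<ominus> x1 \<otimes> z3))"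
proof -
  \<comment> \<open>The letters stand for the monomials after expansion. Here \<open>p\<close> and
    \<open>q\<close>, later \<open>x1 y3 z3\<close> and \<open>x1 y2 z2\<close>, occur only on the
    right, each twice with opposite signs.\<close>
  have cancel: "(a \<ominus> b) \<ominus> (c \<ominus> d) = ((d \<ominus> p) \<ominus> (q \<ominus> a)) \<oplus> ((q \<ominus> b) \<ominus> (c \<ominus> p))"
    if "a \<in> carrier R" "b \<in> carrier R" "c \<in> carrier R" "d \<in> carrier R"
      "p \<in> carrier R" "q \<in> carrier R" for a b c d p q
  proof -
    have "((d \<ominus> p) \<ominus> (q \<ominus> a)) \<oplus> ((q \<ominus> b) \<ominus> (c \<ominus> p)) =
        ((a \<ominus> b) \<ominus> (c \<ominus> d)) \<oplus> ((p \<oplus> \<ominus> p) \<oplus> (q \<oplus> \<ominus> q))"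
      using that by (simp add: a_minus_def minus_add a_ac del: r_neg)
    then show ?thesis using that by (simp add: r_neg)
  qed
  show ?thesis
    using assms cancel[of "x2 \<otimes> (y1 \<otimes> z2)" "x2 \<otimes> (y2 \<otimes> z1)" "x3 \<otimes> (y3 \<otimes> z1)"
      "x3 \<otimes> (y1 \<otimes> z3)" "x1 \<otimes> (y3 \<otimes> z3)" "x1 \<otimes> (y2 \<otimes> z2)"]
    by (simp add: mult_minus_mult m_ac m_comm[of "_ \<ominus> _"])
qed

lemma cross_module: "module R (cross_algebra R)"
proof (rule moduleI)
  show "abelian_group (cross_algebra R)"
  proof (rule abelian_groupI)
    fix x assume x: "x \<in> carrier (cross_algebra R)"
    then show "\<exists>y\<in>carrier (cross_algebra R).
        y \<oplus>\<^bsub>cross_algebra R\<^esub> x = \<zero>\<^bsub>cross_algebra R\<^esub>"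
      by (intro bexI[of _ "\<lambda>n. \<ominus> x n"]) (auto simp: cross_algebra_simps Pi_iff l_neg)
  qed (auto simp: cross_algebra_simps Pi_iff a_ac)
qed (auto simp: cross_algebra_simps Pi_iff l_distr r_distr m_assoc is_cring)

lemma cross_leibniz_algebra: "leibniz_algebra R (cross_algebra R)"
proof (intro leibniz_algebra.intro leibniz_algebra_axioms.intro)
  fix x y z c
  assume "x \<in> carrier (cross_algebra R)" "y \<in> carrier (cross_algebra R)"
    and "z \<in> carrier (cross_algebra R)"
  then have [simp]: "x i \<in> carrier R" "y i \<in> carrier R" "z i \<in> carrier R" for i
    by (auto simp: cross_algebra_simps)
  show "(x \<oplus>\<^bsub>cross_algebra R\<^esub> y) \<otimes>\<^bsub>cross_algebra R\<^esub> z =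
      x \<otimes>\<^bsub>cross_algebra R\<^esub> z \<oplus>\<^bsub>cross_algebra R\<^esub> y \<otimes>\<^bsub>cross_algebra R\<^esub> z"
    by (rule ext) (simp add: cross_algebra_simps cross_bracket_def l_distr add_minus_add)
  show "x \<otimes>\<^bsub>cross_algebra R\<^esub> (y \<oplus>\<^bsub>cross_algebra R\<^esub> z) =
      x \<otimes>\<^bsub>cross_algebra R\<^esub> y \<oplus>\<^bsub>cross_algebra R\<^esub> x \<otimes>\<^bsub>cross_algebra R\<^esub> z"
    by (rule ext) (simp add: cross_algebra_simps cross_bracket_def r_distr add_minus_add)
  show "x \<otimes>\<^bsub>cross_algebra R\<^esub> (y \<otimes>\<^bsub>cross_algebra R\<^esub> z) =
      (x \<otimes>\<^bsub>cross_algebra R\<^esub> y) \<otimes>\<^bsub>cross_algebra R\<^esub> z \<oplus>\<^bsub>cross_algebra R\<^esub>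
      y \<otimes>\<^bsub>cross_algebra R\<^esub> (x \<otimes>\<^bsub>cross_algebra R\<^esub> z)"
  proof
    fix n
    show "(x \<otimes>\<^bsub>cross_algebra R\<^esub> (y \<otimes>\<^bsub>cross_algebra R\<^esub> z)) n =
        ((x \<otimes>\<^bsub>cross_algebra R\<^esub> y) \<otimes>\<^bsub>cross_algebra R\<^esub> z \<oplus>\<^bsub>cross_algebra R\<^esub>
        y \<otimes>\<^bsub>cross_algebra R\<^esub> (x \<otimes>\<^bsub>cross_algebra R\<^esub> z)) n"
      unfolding cross_algebra_simps
      \<comment> \<open>The identity holds block by block: the entries of \<open>x\<close> and
        \<open>y\<close> come from block 0 and those of \<open>z\<close> from the block containing
        \<open>n\<close>.\<close>
      by (cases n rule: mod3_cases)
        (simp_all only: cross_bracket_block cross_bracket_zeroth, (rule cross_leibniz_coordinate; simp)+)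
  qed
  assume "c \<in> carrier R"
  then show "(c \<odot>\<^bsub>cross_algebra R\<^esub> x) \<otimes>\<^bsub>cross_algebra R\<^esub> y =
      c \<odot>\<^bsub>cross_algebra R\<^esub> (x \<otimes>\<^bsub>cross_algebra R\<^esub> y)"
    by (intro ext) (simp add: cross_algebra_simps cross_bracket_def mult_minus_mult m_ac)
  show "x \<otimes>\<^bsub>cross_algebra R\<^esub> (c \<odot>\<^bsub>cross_algebra R\<^esub> y) =
      c \<odot>\<^bsub>cross_algebra R\<^esub> (x \<otimes>\<^bsub>cross_algebra R\<^esub> y)"
    using \<open>c \<in> carrier R\<close>
    by (intro ext) (simp add: cross_algebra_simps cross_bracket_def mult_minus_mult m_ac)
qed (auto simp: cross_module field_axioms cross_bracket_closed cross_algebra_simps)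

interpretation C: leibniz_algebra R "cross_algebra R"
  by (rule cross_leibniz_algebra)

section \<open>The ideals formed by the tails\<close>

lemma tail_closed: "f \<in> tail R n \<Longrightarrow> f \<in> UNIV \<rightarrow> carrier R"
  by (simp add: tail_def)

lemma tail_zeroth:
  assumes "f \<in> tail R n" "n \<ge> 1"
  shows "f 0 = \<zero>" "f 1 = \<zero>" "f 2 = \<zero>"
  using assms by (auto simp: tail_def)

lemma tail_block:
  assumes "f \<in> tail R n" "q < n"
  shows "f (3 * q) = \<zero>" "f (3 * q + 1) = \<zero>" "f (3 * q + 2) = \<zero>"
  using assms by (auto simp: tail_def)

text \<open>For \<open>n \<ge> 1\<close> block 0 of \<open>f\<close> vanishes, and the bracket sees
  nothing else of its left factor. In particular \<open>A\<close> is abelian.\<close>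

lemma cross_bracket_tail_left:
  assumes "f \<in> tail R n" "n \<ge> 1" "g \<in> UNIV \<rightarrow> carrier R"
  shows "cross_bracket R f g = (\<lambda>_. \<zero>)"
  using assms by (intro ext) (simp add: cross_bracket_def tail_zeroth[OF assms(1,2), simplified] Pi_iff)

text \<open>The left action works on each block of \<open>g\<close> separately, so a zero block
  stays zero.\<close>

lemma cross_bracket_tail_right:
  assumes f: "f \<in> UNIV \<rightarrow> carrier R" and g: "g \<in> tail R n"
  shows "cross_bracket R f g \<in> tail R n"
proof -
  have "cross_bracket R f g k = \<zero>" if "k < 3 * n" for k
    using that f tail_block[OF g]
    by (cases k rule: mod3_cases) (simp_all only: cross_bracket_block, simp_all add: Pi_iff)
  then show ?thesis
    using cross_bracket_closed[OF f tail_closed[OF g]] by (simp add: tail_def)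
qed

lemma zero_in_tail: "(\<lambda>_. \<zero>) \<in> tail R n"
  by (simp add: tail_def)

lemma tail_submodule: "submodule (tail R n) R (cross_algebra R)"
proof (rule C.submoduleI)
  fix f assume f: "f \<in> tail R n"
  \<comment> \<open>The additive inverse is a definite description; as scaling by
    \<open>\<ominus> \<one>\<close> it can be computed coordinatewise.\<close>
  have "\<ominus>\<^bsub>cross_algebra R\<^esub> f = (\<ominus> \<one>) \<odot>\<^bsub>cross_algebra R\<^esub> f"
    using f by (simp add: C.smult_l_minus tail_def cross_algebra_simps(1))
  then show "\<ominus>\<^bsub>cross_algebra R\<^esub> f \<in> tail R n"
    using f by (auto simp: tail_def cross_algebra_simps)
qed (auto simp: tail_def cross_algebra_simps)

lemma tail_ideal:
  assumes "n \<ge> 1"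
  shows "leibniz_ideal R (cross_algebra R) (tail R n)"
  using assms unfolding leibniz_ideal_def
  by (simp add: tail_submodule cross_algebra_simps cross_bracket_tail_right
      cross_bracket_tail_left zero_in_tail)

lemma unit_seq_closed: "unit_seq R i \<in> UNIV \<rightarrow> carrier R"
  by (simp add: unit_seq_def)

section \<open>Perfectness and the failure of the left chain condition\<close>

text \<open>The cross product with the first basis vector reaches coordinates 1 and 2 of a block,
  that with the second supplies coordinate 0. As \<open>v\<close> and \<open>w\<close> are
  prescribed only on block 0, they may be unit sequences, giving perfectness, or elements of an
  ideal whose other blocks are unknown, giving simplicity of \<open>L / A\<close>.\<close>

lemma cross_bracket_decomposition:
  assumes y: "y \<in> tail R n"
    and v: "v 0 = \<one>" "v 1 = \<zero>" "v 2 = \<zero>"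
    and w: "w 0 = \<zero>" "w 1 = \<one>" "w 2 = \<zero>"
  shows "\<exists>f\<in>tail R n. \<exists>g\<in>tail R n.
    y = (\<lambda>k. cross_bracket R v f k \<oplus> cross_bracket R w g k)"
proof -
  \<comment> \<open>\<open>(a, b, c) = e\<^sub>0 \<times> (0, c, -b) + e\<^sub>1 \<times> (0, 0, a)\<close>\<close>
  define f where "f k = (if k mod 3 = 1 then y (k + 1) else if k mod 3 = 2 then \<ominus> y (k - 1) else \<zero>)" for k
  define g where "g k = (if k mod 3 = 2 then y (k - 2) else \<zero>)" for k
  have y': "y k \<in> carrier R" for k using y by (auto simp: tail_def)
  have m: "(3 * q + 1) mod 3 = 1" "(3 * q + 2) mod 3 = 2" for q :: nat by presburger+
  have fq: "f (3 * q) = \<zero>" "f (3 * q + 1) = y (3 * q + 2)" "f (3 * q + 2) = \<ominus> y (3 * q + 1)" for q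
    using m[of q] by (simp_all add: f_def)
  have gq: "g (3 * q) = \<zero>" "g (3 * q + 1) = \<zero>" "g (3 * q + 2) = y (3 * q)" for q
    using m[of q] by (simp_all add: g_def)
  have "y k = cross_bracket R v f k \<oplus> cross_bracket R w g k" for k
    by (cases k rule: mod3_cases)
      (simp_all only: cross_bracket_block fq gq v w, simp_all add: y' a_minus_def)
  moreover have "f k = \<zero> \<and> g k = \<zero>" if "k < 3 * n" for k
    using that tail_block[OF y]
    by (cases k rule: mod3_cases) (simp_all only: fq gq, simp_all)
  ultimately show ?thesis
    using y' by (intro bexI[of _ f] bexI[of _ g]) (auto simp: tail_def f_def g_def)
qed

lemma unit_seq_simps: "unit_seq R i i = \<one>" "i \<noteq> n \<Longrightarrow> unit_seq R i n = \<zero>"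
  by (auto simp: unit_seq_def)

text \<open>The case \<open>n = 0\<close> makes the algebra perfect; for \<open>n \<ge> 1\<close> it
  shows that bracketing with the algebra does not shrink the terms of the chain.\<close>

lemma tail_subset_bracket_span:
  "tail R n \<subseteq> bracket_span R (cross_algebra R) (UNIV \<rightarrow> carrier R) (tail R n)"
proof
  fix y assume "y \<in> tail R n"
  then obtain f g where *: "f \<in> tail R n" "g \<in> tail R n"
    "y = (\<lambda>k. cross_bracket R (unit_seq R 0) f k \<oplus> cross_bracket R (unit_seq R 1) g k)"
    using cross_bracket_decomposition[of y n "unit_seq R 0" "unit_seq R 1"]
    by (auto simp: unit_seq_closed unit_seq_simps)
  show "y \<in> bracket_span R (cross_algebra R) (UNIV \<rightarrow> carrier R) (tail R n)"
    unfolding bracket_span_def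
  proof (intro InterI, elim CollectE conjE)
    fix H assume H: "submodule H R (cross_algebra R)"
      "\<forall>a\<in>UNIV \<rightarrow> carrier R. \<forall>b\<in>tail R n. a \<otimes>\<^bsub>cross_algebra R\<^esub> b \<in> H"
    have "cross_bracket R (unit_seq R 0) f \<in> H" "cross_bracket R (unit_seq R 1) g \<in> H"
      using H(2) *(1,2) unit_seq_closed by (auto simp: cross_algebra_simps)
    from C.submoduleE(5)[OF H(1) this] show "y \<in> H"
      by (simp add: *(3) cross_algebra_simps)
  qed
qed

lemma tail_0: "tail R 0 = UNIV \<rightarrow> carrier R"
  by (simp add: tail_def)

lemma derived_series_cross_algebra:
  "derived_series R (cross_algebra R) n = UNIV \<rightarrow> carrier R"
proof (induction n)
  case (Suc n)
  have "UNIV \<rightarrow> carrier R \<subseteq> derived_series R (cross_algebra R) (Suc n)"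
    using tail_subset_bracket_span[of 0] Suc by (simp add: tail_0)
  then show ?case
    using C.derived_series_subset[of "Suc n"] by (auto simp: cross_algebra_simps(1))
qed (simp add: cross_algebra_simps)

lemma cross_algebra_not_quasi_artinian: "\<not> quasi_artinian R (cross_algebra R)"
proof
  assume "quasi_artinian R (cross_algebra R)"
  moreover have "descending_ideal_chain R (cross_algebra R) (tail R)"
    by (simp add: descending_ideal_chain_def tail_ideal) (auto simp: tail_def)
  ultimately obtain m where "m \<ge> 1" and
    m: "\<And>n. n \<ge> 1 \<Longrightarrow> bracket_span R (cross_algebra R)
      (derived_series R (cross_algebra R) m) (tail R m) \<subseteq> tail R n"
    unfolding quasi_artinian_def left_quasi_artinian_def by blast
  \<comment> \<open>The derived series is constant, so \<open>T m\<close> lies in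
    \<open>[L, T m]\<close>, which the left condition would place inside
    \<open>T (m + 1)\<close>.\<close>
  have "tail R m \<subseteq> tail R (Suc m)"
    using m[of "Suc m"] tail_subset_bracket_span[of m] by (simp add: derived_series_cross_algebra)
  \<comment> \<open>Index \<open>3 * m\<close> is the first entry of block \<open>m\<close>, the one
    block that must vanish in \<open>T (m + 1)\<close> but not in \<open>T m\<close>.\<close>
  moreover have "unit_seq R (3 * m) \<in> tail R m"
    by (simp add: tail_def unit_seq_def)
  moreover have "unit_seq R (3 * m) \<notin> tail R (Suc m)"
    by (auto simp: tail_def unit_seq_def)
  ultimately show False by blast
qed

section \<open>Simplicity of the quotient by \<open>A\<close>, and the series\<close>

text \<open>An ideal outside \<open>A\<close> has an element with a nonzero entry in block 0. Double
  brackets with unit sequences and a scaling turn it into elements of \<open>P\<close> starting with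
  each basis vector, and brackets with two of these on the left already produce every
  sequence.\<close>

lemma cross_ideal_cases:
  assumes P: "leibniz_ideal R (cross_algebra R) P"
  shows "P = UNIV \<rightarrow> carrier R \<or> P \<subseteq> tail R 1"
proof (rule disjCI)
  assume "\<not> P \<subseteq> tail R 1"
  have sub: "submodule P R (cross_algebra R)" using P by (simp add: leibniz_ideal_def)
  note E = C.submoduleE[OF sub, unfolded cross_algebra_simps]
  have br: "cross_bracket R f g \<in> P" "cross_bracket R g f \<in> P"
    if "f \<in> UNIV \<rightarrow> carrier R" "g \<in> P" for f g
    using P that by (auto simp: leibniz_ideal_def cross_algebra_simps)
  have carr: "f i \<in> carrier R" if "f \<in> P" for f i
    using E(1) that by auto
  \<comment> \<open>Only block 0 is prescribed, because the later blocks of the elements constructed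
    in \<open>P\<close> cannot be controlled.\<close>
  define unit_at where "unit_at i w \<longleftrightarrow> (\<forall>k<3. w k = unit_seq R i k)" for i :: nat and w
  have unit_at: "unit_at i w \<longleftrightarrow> w 0 = unit_seq R i 0 \<and> w 1 = unit_seq R i 1 \<and> w 2 = unit_seq R i 2"
    for i w by (auto simp: unit_at_def numeral_3_eq_3 numeral_2_eq_2 less_Suc_eq)
  have unit: "\<exists>w\<in>P. unit_at ((j + 1) mod 3) w" if x: "x \<in> P" "x j \<noteq> \<zero>" and "j < 3" for x j
  proof -
    \<comment> \<open>\<open>e\<^sub>j \<times> (e\<^sub>k \<times> x) = x\<^sub>j e\<^sub>k\<close> for \<open>j \<noteq> k\<close>\<close>
    define w where "w = (\<lambda>n. inv (x j) \<otimes> cross_bracket R (unit_seq R j)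
      (cross_bracket R (unit_seq R ((j + 1) mod 3)) x) n)"
    have inv: "inv (x j) \<in> carrier R" "inv (x j) \<otimes> x j = \<one>"
      using x carr by (simp_all add: field_Units)
    have "w \<in> P" unfolding w_def using E(4)[OF inv(1)] br(1) unit_seq_closed x by blast
    moreover have "j = 0 \<or> j = 1 \<or> j = 2" using \<open>j < 3\<close> by linarith
    then have "unit_at ((j + 1) mod 3) w"
      using inv x(1) unfolding unit_at w_def cross_bracket_zeroth
      by (auto simp: unit_seq_def carr a_minus_def cross_bracket_zeroth[simplified])
    ultimately show ?thesis by blast
  qed
  define S where "S i \<longleftrightarrow> (\<exists>w\<in>P. unit_at i w)" for i
  \<comment> \<open>An element with \<open>i\<close>-th basis vector in block 0 has a nonzero entry
    at \<open>i\<close>, so \<open>unit\<close> applies to it again; going round the cycle reaches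
    all three basis vectors from any one.\<close>
  have step: "S ((i + 1) mod 3)" if "S i" "i < 3" for i
  proof -
    obtain w where "w \<in> P" "unit_at i w" using \<open>S i\<close> by (auto simp: S_def)
    then show ?thesis
      using unit[of w i] \<open>i < 3\<close> by (simp add: S_def unit_at_def unit_seq_def)
  qed
  have steps: "S 0 \<Longrightarrow> S 1" "S 1 \<Longrightarrow> S 2" "S 2 \<Longrightarrow> S 0"
    using step[of 0] step[of 1] step[of 2] by (simp_all add: numeral_2_eq_2)
  obtain x j where x: "x \<in> P" "x j \<noteq> \<zero>" "j < 3"
    using \<open>\<not> P \<subseteq> tail R 1\<close> E(1) by (auto simp: tail_def)
  have "S ((j + 1) mod 3)" using unit[OF x] by (simp add: S_def)
  moreover have "(j + 1) mod 3 = 0 \<or> (j + 1) mod 3 = 1 \<or> (j + 1) mod 3 = 2" by presburger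
  ultimately have "S 0" "S 1" using steps by metis+
  then obtain v w where v: "v \<in> P" "unit_at 0 v" and w: "w \<in> P" "unit_at 1 w"
    by (auto simp: S_def)
  have "y \<in> P" if y: "y \<in> UNIV \<rightarrow> carrier R" for y
  proof -
    obtain f g where "f \<in> UNIV \<rightarrow> carrier R" "g \<in> UNIV \<rightarrow> carrier R"
      "y = (\<lambda>k. cross_bracket R v f k \<oplus> cross_bracket R w g k)"
      using cross_bracket_decomposition[of y 0 v w] y v w E(1)
      unfolding unit_at tail_0 by (auto simp: unit_seq_simps subset_iff)
    \<comment> \<open>Here \<open>v\<close> and \<open>w\<close> are the left factors, so the ideal
      absorbs \<open>f\<close> and \<open>g\<close> from the right.\<close>
    then show ?thesis using br(2) v w E(5) by simp
  qed
  then show "P = UNIV \<rightarrow> carrier R" using E(1) by blast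
qed

text \<open>The series is \<open>0\<close>, \<open>A\<close>, \<open>L\<close>. In the lower factor
  every ideal brackets to zero because \<open>A\<close> is abelian; in the upper one an ideal is
  everything or lies in \<open>A\<close>, hence brackets into \<open>A\<close>.\<close>

lemma cross_algebra_extension:
  "extension_class R (quasi_artinian R) (cross_algebra R)"
proof -
  let ?C = "cross_algebra R"
  let ?A = "?C\<lparr>carrier := tail R 1\<rparr>"
  interpret A: leibniz_algebra R ?A
    by (rule C.subalgebra[OF tail_submodule])
      (simp add: cross_algebra_simps cross_bracket_tail_right tail_closed)
  have abelian: "x \<otimes>\<^bsub>?A\<^esub> y = \<zero>\<^bsub>?A\<^esub>" if "x \<in> tail R 1" "y \<in> tail R 1" for x y
    using that by (simp add: cross_algebra_simps cross_bracket_tail_left[of _ 1] tail_closed)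
  have ideal0: "leibniz_ideal R ?A {\<zero>\<^bsub>?A\<^esub>}"
    by (rule A.zero_ideal)
  have factor0: "quasi_artinian R (quotient_algebra ?A {\<zero>\<^bsub>?A\<^esub>})"
  proof (rule A.quotient_quasi_artinian[OF ideal0])
    fix P assume "leibniz_ideal R ?A P"
    then have "P \<subseteq> tail R 1"
      using A.submoduleE(1) by (simp add: leibniz_ideal_def)
    then show "P = carrier ?A \<or> (\<forall>x\<in>carrier ?A. \<forall>a\<in>P.
        x \<otimes>\<^bsub>?A\<^esub> a \<in> {\<zero>\<^bsub>?A\<^esub>} \<and> a \<otimes>\<^bsub>?A\<^esub> x \<in> {\<zero>\<^bsub>?A\<^esub>})"
      using abelian by auto
  qed
  have factor1: "quasi_artinian R (quotient_algebra ?C (tail R 1))"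
  proof (rule C.quotient_quasi_artinian[OF tail_ideal])
    fix P assume "leibniz_ideal R ?C P"
    then have "P = carrier ?C \<or> P \<subseteq> tail R 1"
      using cross_ideal_cases by (simp add: cross_algebra_simps)
    then show "P = carrier ?C \<or> (\<forall>x\<in>carrier ?C. \<forall>a\<in>P.
        x \<otimes>\<^bsub>?C\<^esub> a \<in> tail R 1 \<and> a \<otimes>\<^bsub>?C\<^esub> x \<in> tail R 1)"
      using tail_ideal[of 1] unfolding leibniz_ideal_def by blast
  qed simp
  define s where "s i = (if i = 0 then {\<zero>\<^bsub>?C\<^esub>} else if i = 1 then tail R 1 else carrier ?C)" for i :: nat
  show ?thesis
    unfolding extension_class_def
  proof (intro conjI exI[of _ 2] exI[of _ s] allI impI)
    fix i :: nat assume "i < 2"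
    then consider "i = 0" | "i = 1" by linarith
    then show "leibniz_ideal R (?C\<lparr>carrier := s (Suc i)\<rparr>) (s i)"
      and "quasi_artinian R (quotient_algebra (?C\<lparr>carrier := s (Suc i)\<rparr>) (s i))"
      using ideal0 tail_ideal[of 1] factor0 factor1
      \<comment> \<open>At \<open>i = 1\<close> the carrier of \<open>?C\<close> is updated to
        itself; unfolding \<open>cross_algebra_def\<close> identifies the result with
        \<open>?C\<close>.\<close>
      by (cases; simp add: s_def; simp add: cross_algebra_def)+
  qed (simp_all add: s_def cross_leibniz_algebra cross_algebra_simps)
qed

end

theorem mainTheorem4:
  fixes K :: "('k, 'm) ring_scheme"
  assumes "field K"
  shows "\<exists>L :: ('k, nat \<Rightarrow> 'k) module.
    leibniz_algebra K L \<and>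
    extension_class K (quasi_artinian K) L \<and>
    \<not> quasi_artinian K L"
  using field.cross_leibniz_algebra[OF assms] field.cross_algebra_extension[OF assms]
    field.cross_algebra_not_quasi_artinian[OF assms] by blast

end
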